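(* Let $f(x;\mu)$ be a regular natural exponential family in its mean parametrization, let $g(x;\mu,\lambda)=f(x;\mu)+\sum_{k=2}^{r}\lambda_k f^{(k)}(x;\mu)$, $\lambda=(\lambda_2,\dots,\lambda_r)$, be its local mixture model of order $r$, let $\mu_0$ be a fixed, known value of the mean parameter, and let $x_1,\dots,x_n$ be a random sample with values in the support $S$ of $\nu$. Then the log-likelihood function for $\lambda$ based on the density function $g(x;\mu_0,\lambda)$, $$\ell(\lambda)=\sum_{i=1}^{n}\log g(x_i;\mu_0,\lambda),$$ is a concave function of $\lambda$ on the (convex) set of those $\lambda\in\mathbf{R}^{r-1}$ for which $g(\cdot;\mu_0,\lambda)$ is a density, i.e. $g(x;\mu_0,\lambda)\ge 0$ for all $x\in S$ (with the convention $\log 0=-\infty$).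
   Context: A univariate natural exponential family on $\mathbf{R}$ with respect to a $\sigma$-finite measure $\nu$ has densities $\exp\{\theta x-k_\nu(\theta)\}$ with respect to $\nu$, with natural parameter $\theta$. The mean parametrization is $\mu=\mathrm{E}_\theta(X)$, and $f(x;\mu)$ denotes the density (with respect to $\nu$) in terms of $\mu$. Write $f^{(k)}(x;\mu)=\frac{\partial^k}{\partial\mu^k}f(x;\mu)$. Standing regularity: usual regularity conditions on the family are assumed (smoothness in the parameter, interchange of differentiation in $\mu$ and integration in $x$), under which $f(\cdot;\mu)\in L^2(\nu)$ with $\int f\,\mathrm{d}\nu=1$ and all $f^{(k)}(\cdot;\mu)$ lie in $L^2(\nu)$ and integrate to $0$. $S$ denotes the support of $\nu$. The model $g(x;\mu_0,\lambda)$ for fixed $\mu_0$ is called the fiber at $\mu_0$. *)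

theory Defs
  imports "HOL-Analysis.Analysis"
begin

definition nat_param_space :: "real measure \<Rightarrow> real set" where
  "nat_param_space \<nu> = {\<theta>. integrable \<nu> (\<lambda>x. exp (\<theta> * x))}"

definition cumulant :: "real measure \<Rightarrow> real \<Rightarrow> real" where
  "cumulant \<nu> \<theta> = ln (\<integral>x. exp (\<theta> * x) \<partial>\<nu>)"

definition nef_density :: "real measure \<Rightarrow> real \<Rightarrow> real \<Rightarrow> real" where
  "nef_density \<nu> \<theta> x = exp (\<theta> * x - cumulant \<nu> \<theta>)"

definition nef_mean :: "real measure \<Rightarrow> real \<Rightarrow> real" where
  "nef_mean \<nu> \<theta> = (\<integral>x. x * nef_density \<nu> \<theta> x \<partial>\<nu>)"

definition mean_space :: "real measure \<Rightarrow> real set" where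
  "mean_space \<nu> = nef_mean \<nu> ` nat_param_space \<nu>"

text \<open>On a regular family (below) the mean map is injective, so that
  \<^term>\<open>inv_into\<close> is its genuine inverse on the mean space.\<close>

definition mean_density :: "real measure \<Rightarrow> real \<Rightarrow> real \<Rightarrow> real" where
  "mean_density \<nu> \<mu> x = nef_density \<nu> (inv_into (nat_param_space \<nu>) (nef_mean \<nu>) \<mu>) x"

definition mean_density_deriv :: "real measure \<Rightarrow> nat \<Rightarrow> real \<Rightarrow> real \<Rightarrow> real" where
  "mean_density_deriv \<nu> k \<mu> x = (deriv ^^ k) (\<lambda>m. mean_density \<nu> m x) \<mu>"

text \<open>The family is regular if the full natural parameter space is open and the base measure is
  not concentrated at one point (so that the mean is a parameter). The last conjunct collects the
  regularity conditions at every mean value: smoothness in the mean, square integrability and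
  integrability of all derivatives, interchange of differentiation and integration, and
  the vanishing of the integrals of the derivatives.\<close>

definition regular_nef :: "real measure \<Rightarrow> bool" where
  "regular_nef \<nu> \<longleftrightarrow>
     sets \<nu> = sets borel \<and> sigma_finite_measure \<nu> \<and>
     open (nat_param_space \<nu>) \<and> nat_param_space \<nu> \<noteq> {} \<and>
     \<not> (\<exists>c. AE x in \<nu>. x = c) \<and>
     (\<forall>\<mu>\<in>mean_space \<nu>. \<forall>k.
        (\<forall>x. ((\<lambda>m. mean_density_deriv \<nu> k m x)
               has_real_derivative mean_density_deriv \<nu> (Suc k) \<mu> x) (at \<mu>)) \<and>
        integrable \<nu> (mean_density_deriv \<nu> k \<mu>) \<and>
        integrable \<nu> (\<lambda>x. (mean_density_deriv \<nu> k \<mu> x)\<^sup>2) \<and>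
        ((\<lambda>m. \<integral>x. mean_density_deriv \<nu> k m x \<partial>\<nu>)
           has_real_derivative (\<integral>x. mean_density_deriv \<nu> (Suc k) \<mu> x \<partial>\<nu>)) (at \<mu>) \<and>
        (1 \<le> k \<longrightarrow> (\<integral>x. mean_density_deriv \<nu> k \<mu> x \<partial>\<nu>) = 0))"

definition msupport :: "real measure \<Rightarrow> real set" where
  "msupport \<nu> = {x. \<forall>U. open U \<longrightarrow> x \<in> U \<longrightarrow> emeasure \<nu> U > 0}"

text \<open>The parameter vector of a local mixture model of order \<^term>\<open>r\<close> has components
  numbered 2 to \<^term>\<open>r\<close>. It is represented as a vector over a finite type, together
  with a numbering \<^term>\<open>d\<close>, a bijection from that type onto \<^term>\<open>{2..r::nat}\<close>:
  component \<^term>\<open>j\<close> is the coefficient of the derivative of order \<^term>\<open>d j\<close>.\<close>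

definition local_mixture ::
    "real measure \<Rightarrow> ('k::finite \<Rightarrow> nat) \<Rightarrow> real \<Rightarrow> real ^ 'k \<Rightarrow> real \<Rightarrow> real" where
  "local_mixture \<nu> d \<mu> l x =
     mean_density \<nu> \<mu> x + (\<Sum>j\<in>UNIV. (l $ j) * mean_density_deriv \<nu> (d j) \<mu> x)"

text \<open>Nonnegativity on the support is all that is needed for a density, since the total integral
  is always one, see \<open>local_mixture_integral\<close> below.\<close>

definition density_params :: "real measure \<Rightarrow> ('k::finite \<Rightarrow> nat) \<Rightarrow> real \<Rightarrow> (real ^ 'k) set" where
  "density_params \<nu> d \<mu> = {l. \<forall>x\<in>msupport \<nu>. 0 \<le> local_mixture \<nu> d \<mu> l x}"

text \<open>Only nonnegative arguments matter; at 0 the library value \<open>ln 0 = 0\<close> is not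
  the intended one.\<close>

definition log_ereal :: "real \<Rightarrow> ereal" where
  "log_ereal t = (if t \<le> 0 then - \<infinity> else ereal (ln t))"

definition log_likelihood ::
    "real measure \<Rightarrow> ('k::finite \<Rightarrow> nat) \<Rightarrow> real \<Rightarrow> nat \<Rightarrow> (nat \<Rightarrow> real) \<Rightarrow> real ^ 'k \<Rightarrow> ereal" where
  "log_likelihood \<nu> d \<mu> n x l = (\<Sum>i=1..n. log_ereal (local_mixture \<nu> d \<mu> l (x i)))"

text \<open>Concavity of a function with values below \<open>\<infinity>\<close>; in the boundary cases
  the library convention \<open>0 * (- \<infinity>) = 0\<close> makes the inequality trivial.\<close>

definition ereal_concave_on :: "'a::real_vector set \<Rightarrow> ('a \<Rightarrow> ereal) \<Rightarrow> bool" where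
  "ereal_concave_on C h \<longleftrightarrow>
     convex C \<and>
     (\<forall>a\<in>C. \<forall>b\<in>C. \<forall>u\<ge>0. \<forall>v\<ge>0. u + v = 1 \<longrightarrow>
        ereal u * h a + ereal v * h b \<le> h (u *\<^sub>R a + v *\<^sub>R b))"

lemma mean_density_integral:
  assumes "regular_nef \<nu>" "\<mu> \<in> mean_space \<nu>"
  shows "(\<integral>x. mean_density \<nu> \<mu> x \<partial>\<nu>) = 1"
proof -
  define t where "t = inv_into (nat_param_space \<nu>) (nef_mean \<nu>) \<mu>"
  have "t \<in> nat_param_space \<nu>"
    using assms(2) unfolding t_def mean_space_def by (rule inv_into_into)
  then have int: "integrable \<nu> (\<lambda>x. exp (t * x))"
    by (simp add: nat_param_space_def)
  define I where "I = (\<integral>x. exp (t * x) \<partial>\<nu>)"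
  have "I \<noteq> 0"
  proof
    assume "I = 0"
    then have "AE x in \<nu>. exp (t * x) = 0"
      using integral_nonneg_eq_0_iff_AE[OF int] by (simp add: I_def)
    then have "AE x in \<nu>. x = 0"
      by eventually_elim simp
    then show False
      using assms(1) unfolding regular_nef_def by blast
  qed
  moreover have "I \<ge> 0"
    unfolding I_def by simp
  ultimately have pos: "I > 0"
    by simp
  have "mean_density \<nu> \<mu> = (\<lambda>x. exp (t * x) / I)"
    using pos
    by (simp add: fun_eq_iff mean_density_def nef_density_def t_def[symmetric] cumulant_def
        I_def[symmetric] exp_diff)
  then have "(\<integral>x. mean_density \<nu> \<mu> x \<partial>\<nu>) = I / I"
    by (simp add: I_def)
  then show ?thesis
    using pos by simp
qed

lemma local_mixture_integral:
  assumes "regular_nef \<nu>" "\<mu> \<in> mean_space \<nu>" "bij_betw d UNIV {2..r}"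
  shows "(\<integral>x. local_mixture \<nu> d \<mu> l x \<partial>\<nu>) = 1"
proof -
  have int: "integrable \<nu> (mean_density_deriv \<nu> k \<mu>)" for k
    using assms(1,2) unfolding regular_nef_def by blast
  have int0: "integrable \<nu> (mean_density \<nu> \<mu>)"
    using int[of 0] by (simp add: mean_density_deriv_def[abs_def])
  have "d j \<in> {2..r}" for j
    using assms(3) by (auto simp: bij_betw_def)
  then have "1 \<le> d j" for j
    by (metis atLeastAtMost_iff one_le_numeral order_trans)
  then have zero: "(\<integral>x. mean_density_deriv \<nu> (d j) \<mu> x \<partial>\<nu>) = 0" for j
    using assms(1,2) unfolding regular_nef_def by blast
  show ?thesis
    unfolding local_mixture_def
    by (simp add: int int0 zero mean_density_integral[OF assms(1,2)])
qed

end

theory Submission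
  imports Defs
begin

text \<open>For a fixed mean and a fixed observation the local mixture density is an affine function
  of the parameter vector (\<open>local_mixture_affine\<close>). The admissible vectors therefore
  form an intersection of closed half-spaces (or trivial conditions), one for each support point,
  which is convex. The logarithm, with value minus infinity at 0, is concave on the nonnegative
  reals (\<open>log_ereal_concave\<close>). Concavity survives composition with an affine map and
  finite summation (\<open>ereal_concave_on_sum\<close>), which gives the log-likelihood.\<close>

lemma log_ereal_concave: "ereal_concave_on {0..} log_ereal"
  unfolding ereal_concave_on_def
proof (intro conjI ballI allI impI)
  show "convex {0::real..}" by (rule convex_real_interval)
next
  fix a b u v :: real
  assume ab: "a \<in> {0..}" "b \<in> {0..}" and uv: "0 \<le> u" "0 \<le> v" "u + v = 1"
  consider "u = 0" | "v = 0" | "u > 0" "v > 0" "a = 0 \<or> b = 0"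
    | "u > 0" "v > 0" "a > 0" "b > 0"
    using ab uv by fastforce
  then show "ereal u * log_ereal a + ereal v * log_ereal b \<le> log_ereal (u *\<^sub>R a + v *\<^sub>R b)"
  proof cases
    \<comment> \<open>With both weights positive, a zero argument makes one term minus infinity, and
      the other term is never plus infinity.\<close>
    case 3
    then have "ereal u * log_ereal a + ereal v * log_ereal b = - \<infinity>"
      by (auto simp: log_ereal_def)
    then show ?thesis by (simp only: ereal_less_eq)
  next
    case 4
    have "u * ln a + v * ln b \<le> ln (u *\<^sub>R a + v *\<^sub>R b)"
      using ln_concave 4 uv by (simp add: concave_on_iff)
    moreover have "u * a + v * b > 0"
      using 4 by (simp add: add_pos_pos)
    ultimately show ?thesis
      using 4 by (simp add: log_ereal_def)
  \<comment> \<open>If one weight is 0, the other is 1, and \<open>0 * (- \<infinity>) = 0\<close>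
    leaves an equality.\<close>
  qed (use uv in \<open>simp_all flip: zero_ereal_def one_ereal_def\<close>)
qed

text \<open>Convexity of \<open>C\<close> is assumed separately because an empty \<open>I\<close>,
  that is an empty sample, supplies none.\<close>

lemma ereal_concave_on_sum:
  assumes "convex C"
    and "\<And>i. i \<in> I \<Longrightarrow> ereal_concave_on C (h i)"
  shows "ereal_concave_on C (\<lambda>l. \<Sum>i\<in>I. h i l)"
  unfolding ereal_concave_on_def
proof (intro conjI ballI allI impI)
  fix a b :: 'a and u v :: real
  assume ab: "a \<in> C" "b \<in> C" and uv: "0 \<le> u" "0 \<le> v" "u + v = 1"
  \<comment> \<open>Distributivity can fail in \<open>ereal\<close>, but it holds for a finite
    nonnegative factor, whatever infinities occur in the sum.\<close>
  have distrib: "ereal w * (\<Sum>i\<in>I. h i l) = (\<Sum>i\<in>I. ereal w * h i l)" if "0 \<le> w" for w l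
    using that by (induction I rule: infinite_finite_induct) (simp_all add: ereal_pos_distrib)
  have "ereal u * (\<Sum>i\<in>I. h i a) + ereal v * (\<Sum>i\<in>I. h i b)
      = (\<Sum>i\<in>I. ereal u * h i a + ereal v * h i b)"
    using uv by (simp add: distrib sum.distrib)
  also have "\<dots> \<le> (\<Sum>i\<in>I. h i (u *\<^sub>R a + v *\<^sub>R b))"
    using assms(2) ab uv by (intro sum_mono) (simp add: ereal_concave_on_def)
  finally show "ereal u * (\<Sum>i\<in>I. h i a) + ereal v * (\<Sum>i\<in>I. h i b)
      \<le> (\<Sum>i\<in>I. h i (u *\<^sub>R a + v *\<^sub>R b))" .
qed (fact assms(1))

lemma local_mixture_affine:
  assumes "u + v = 1"
  shows "local_mixture \<nu> d \<mu> (u *\<^sub>R a + v *\<^sub>R b) x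
       = u * local_mixture \<nu> d \<mu> a x + v * local_mixture \<nu> d \<mu> b x"
proof -
  \<comment> \<open>The term free of the parameter makes the map affine rather than linear;
    splitting it is where \<open>u + v = 1\<close> enters.\<close>
  have "mean_density \<nu> \<mu> x = u * mean_density \<nu> \<mu> x + v * mean_density \<nu> \<mu> x"
    using assms by (simp flip: distrib_right)
  then show ?thesis
    by (simp add: local_mixture_def algebra_simps sum.distrib sum_distrib_left)
qed

lemma convex_density_params: "convex (density_params \<nu> d \<mu>)"
  by (rule convexI) (simp add: density_params_def local_mixture_affine)

theorem theorem4:
  fixes \<nu> :: "real measure" and r n :: nat and d :: "'k::finite \<Rightarrow> nat"
    and \<mu>\<^sub>0 :: real and x :: "nat \<Rightarrow> real"
  assumes "regular_nef \<nu>"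
    and "bij_betw d UNIV {2..r}"
    and "\<mu>\<^sub>0 \<in> mean_space \<nu>"
    and "\<And>i. i \<in> {1..n} \<Longrightarrow> x i \<in> msupport \<nu>"
  shows "convex (density_params \<nu> d \<mu>\<^sub>0) \<and>
         ereal_concave_on (density_params \<nu> d \<mu>\<^sub>0) (log_likelihood \<nu> d \<mu>\<^sub>0 n x)"
proof
  show cvx: "convex (density_params \<nu> d \<mu>\<^sub>0)"
    by (rule convex_density_params)
  have "ereal_concave_on (density_params \<nu> d \<mu>\<^sub>0) (\<lambda>l. log_ereal (local_mixture \<nu> d \<mu>\<^sub>0 l (x i)))"
    if "i \<in> {1..n}" for i
    \<comment> \<open>As \<open>x i\<close> lies in the support, admissible vectors give nonnegative
      arguments, so \<open>log_ereal_concave\<close> applies to them.\<close>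
    using log_ereal_concave cvx assms(4)[OF that]
    by (simp add: ereal_concave_on_def local_mixture_affine density_params_def)
  with cvx show "ereal_concave_on (density_params \<nu> d \<mu>\<^sub>0) (log_likelihood \<nu> d \<mu>\<^sub>0 n x)"
    unfolding log_likelihood_def by (rule ereal_concave_on_sum)
qed

end
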